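(* Let $k\ge1$ be an integer, let $d\in A_k$, and let $(\lambda^{(0)},\lambda^{(1/2)},\lambda^{(1)},\ldots,\lambda^{(2k-1/2)},\lambda^{(2k)})$ be the sequence of partitions produced from $d$ by the insertion map defined in the context. Then $d$ is planar if and only if every partition $\lambda^{(i)}$ in the sequence satisfies $\ell(\lambda^{(i)})\le 1$.
   Context: $A_k$ is the set of set partitions of $\{1,\ldots,k,1',\ldots,k'\}$. A set partition $d\in A_k$ is represented by any graph with vertices $1,\ldots,k$ in a top row and $1',\ldots,k'$ in a bottom row (in order, left to right) whose connected components are the blocks of $d$. It is planar if it can be represented by such a graph drawn without edge crossings inside the rectangle formed by its vertices. For a partition $\lambda$, $\ell(\lambda)$ is its number of nonzero parts. Standard representation of $d\in A_k$: relabel the vertex $j'$ as $2k-j+1$, so that $d$ becomes a set partition of $\{1,\ldots,2k\}$, drawn with vertices in a row. Connect $i<j$ by an edge if and only if $i,j$ are in the same block and no $m$ with $i<m<j$ is in that block. Label each edge by $2k+1-\ell$, where $\ell$ is its right (larger) endpoint. Each vertex is the left endpoint of at most one edge and the right endpoint of at most one edge. Insertion sequence of $d$: $E=(E_{1/2},E_1,E_{3/2},\ldots,E_{2k-1/2},E_{2k})$, where for each integer $1\le j\le 2k$: $E_j=a$ if vertex $j$ is the left endpoint of the edge labeled $a$, and $E_j=\emptyset$ if $j$ is not a left endpoint; $E_{j-1/2}=a$ if vertex $j$ is the right endpoint of the edge labeled $a$, and $E_{j-1/2}=\emptyset$ if $j$ is not a right endpoint. A "tableau" is a filling of a Young diagram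 (English convention) by distinct positive integers increasing along rows and down columns. Jeu de taquin deletion of an entry $x$: while the box of $x$ is not a corner (end of both its row and column), exchange $x$ with the smaller of the entries immediately below and immediately to the right (or the only one that exists); then delete the corner containing $x$. RSK row insertion of $x$: let $R$ be the first row; while $x$ is less than some element of $R$, replace the smallest element $y>x$ of $R$ by $x$, set $x:=y$, and let $R$ be the next row; finally place $x$ at the end of $R$. Insertion map: let $T^{(0)}=\emptyset$. For $0\le j\le 2k-1$, $T^{(j+1/2)}$ is $T^{(j)}$ with $E_{j+1/2}$ deleted by jeu de taquin if $E_{j+1/2}\ne\emptyset$, and $T^{(j+1/2)}=T^{(j)}$ otherwise; $T^{(j+1)}$ is $T^{(j+1/2)}$ with $E_{j+1}$ row-inserted if $E_{j+1}\neq\emptyset$, and $T^{(j+1)}=T^{(j+1/2)}$ otherwise. $\lambda^{(i)}$ is the shape of $T^{(i)}$ for all $i\in\{0,\frac12,1,\ldots,2k\}$. *)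

theory Defs
  imports "HOL-Analysis.Analysis" "HOL-Library.Disjoint_Sets"
begin

section \<open>Set partitions and planarity\<close>

text \<open>\<open>Top j\<close> is the vertex $j$ and \<open>Bot j\<close> is the vertex $j'$.\<close>

datatype vertex = Top nat | Bot nat

definition vertices :: "nat \<Rightarrow> vertex set" where
  "vertices k = Top ` {1..k} \<union> Bot ` {1..k}"

definition partitions :: "nat \<Rightarrow> vertex set set set" where
  "partitions k = {d. partition_on (vertices k) d}"

text \<open>Finite simple graphs are given by their sets of two-element edges.\<close>

definition graph_on :: "'v set \<Rightarrow> 'v set set \<Rightarrow> bool" where
  "graph_on V G \<longleftrightarrow> (\<forall>e\<in>G. e \<subseteq> V \<and> card e = 2)"

definition graph_components :: "'v set \<Rightarrow> 'v set set \<Rightarrow> 'v set set" where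
  "graph_components V G = V // {(u, v). {u, v} \<in> G}\<^sup>*"

definition represents :: "nat \<Rightarrow> vertex set set \<Rightarrow> vertex set set \<Rightarrow> bool" where
  "represents k G d \<longleftrightarrow> graph_on (vertices k) G \<and> graph_components (vertices k) G = d"

fun position :: "vertex \<Rightarrow> real \<times> real" where
  "position (Top j) = (real j, 1)"
| "position (Bot j) = (real j, 0)"

text \<open>
  The rectangle is closed, so edges may run along its boundary. For \<open>k = 1\<close> it degenerates to
  the segment joining the two vertices.
\<close>

definition rectangle :: "nat \<Rightarrow> (real \<times> real) set" where
  "rectangle k = cbox (1, 0) (real k, 1)"

text \<open>
  A crossing-free drawing: every edge is a simple arc that joins its end vertices and avoids all
  other vertices, and two different edges meet at most in a common end vertex.
\<close>

definition plane_drawing ::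
    "nat \<Rightarrow> vertex set set \<Rightarrow> (vertex set \<Rightarrow> real \<Rightarrow> real \<times> real) \<Rightarrow> bool" where
  "plane_drawing k G \<gamma> \<longleftrightarrow>
     (\<forall>e\<in>G. arc (\<gamma> e) \<and> path_image (\<gamma> e) \<subseteq> rectangle k \<and>
        {pathstart (\<gamma> e), pathfinish (\<gamma> e)} = position ` e \<and>
        path_image (\<gamma> e) \<inter> position ` vertices k = position ` e) \<and>
     (\<forall>e\<in>G. \<forall>e'\<in>G. e \<noteq> e' \<longrightarrow>
        path_image (\<gamma> e) \<inter> path_image (\<gamma> e') = position ` (e \<inter> e'))"

definition planar :: "nat \<Rightarrow> vertex set set \<Rightarrow> bool" where
  "planar k d \<longleftrightarrow> (\<exists>G \<gamma>. represents k G d \<and> plane_drawing k G \<gamma>)"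

section \<open>Standard representation and insertion sequence\<close>

fun relabel :: "nat \<Rightarrow> vertex \<Rightarrow> nat" where
  "relabel k (Top j) = j"
| "relabel k (Bot j) = 2 * k + 1 - j"

definition std_edges :: "nat \<Rightarrow> vertex set set \<Rightarrow> (nat \<times> nat) set" where
  "std_edges k d = {(i, j). i < j \<and>
     (\<exists>B\<in>d. i \<in> relabel k ` B \<and> j \<in> relabel k ` B \<and>
        (\<forall>m. i < m \<and> m < j \<longrightarrow> m \<notin> relabel k ` B))}"

fun edge_label :: "nat \<Rightarrow> nat \<times> nat \<Rightarrow> nat" where
  "edge_label k (i, j) = 2 * k + 1 - j"

text \<open>
  Half-integer indices are doubled throughout: \<open>insertion_seq k d n\<close> is $E_{n/2}$ (for
  \<open>1 \<le> n \<le> 4 * k\<close>), with \<open>None\<close> for $\emptyset$. So \<open>n = 2 * j\<close> asks for the edge with left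
  endpoint \<open>j\<close>, and \<open>n = 2 * j - 1\<close> for the edge with right endpoint \<open>j\<close>; there is at most one
  such edge in either case.
\<close>

definition label_if_edge :: "nat \<Rightarrow> (nat \<times> nat) set \<Rightarrow> nat option" where
  "label_if_edge k S = (if S = {} then None else Some (edge_label k (THE e. e \<in> S)))"

definition insertion_seq :: "nat \<Rightarrow> vertex set set \<Rightarrow> nat \<Rightarrow> nat option" where
  "insertion_seq k d n =
     (if even n then label_if_edge k {e \<in> std_edges k d. fst e = n div 2}
      else label_if_edge k {e \<in> std_edges k d. snd e = (n + 1) div 2})"

section \<open>Tableaux\<close>

text \<open>
  A tableau is the list of its rows, top row first; boxes are (row, column) pairs counted from 0.
\<close>

type_synonym tableau = "nat list list"

definition boxes :: "tableau \<Rightarrow> (nat \<times> nat) set" where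
  "boxes T = {(i, j). i < length T \<and> j < length (T ! i)}"

fun entry :: "tableau \<Rightarrow> nat \<times> nat \<Rightarrow> nat" where
  "entry T (i, j) = T ! i ! j"

fun set_entry :: "tableau \<Rightarrow> nat \<times> nat \<Rightarrow> nat \<Rightarrow> tableau" where
  "set_entry T (i, j) x = T[i := (T ! i)[j := x]]"

definition exchange :: "tableau \<Rightarrow> nat \<times> nat \<Rightarrow> nat \<times> nat \<Rightarrow> tableau" where
  "exchange T b c = set_entry (set_entry T b (entry T c)) c (entry T b)"

definition box_of :: "tableau \<Rightarrow> nat \<Rightarrow> nat \<times> nat" where
  "box_of T x = (THE b. b \<in> boxes T \<and> entry T b = x)"

text \<open>Rows that become empty are dropped, so that shapes have no zero parts.\<close>

definition delete_corner :: "tableau \<Rightarrow> nat \<Rightarrow> tableau" where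
  "delete_corner T i = filter (\<lambda>R. R \<noteq> []) (T[i := butlast (T ! i)])"

lemma map_length_set_entry [simp]: "map length (set_entry T b x) = map length T"
proof (cases b)
  case (Pair i j)
  then show ?thesis
    by (cases "i < length T") (simp_all add: map_update list_update_same_conv list_update_beyond)
qed

lemma map_length_exchange [simp]: "map length (exchange T b c) = map length T"
  by (simp add: exchange_def)

lemma length_exchange [simp]: "length (exchange T b c) = length T"
  by (metis length_map map_length_exchange)

text \<open>\<open>jdt_slide T i j\<close> moves the entry in box \<open>(i, j)\<close> to a corner, which it then deletes.\<close>

function jdt_slide :: "tableau \<Rightarrow> nat \<Rightarrow> nat \<Rightarrow> tableau" where
  "jdt_slide T i j =
     (if (i + 1, j) \<in> boxes T \<and>
         ((i, j + 1) \<in> boxes T \<longrightarrow> entry T (i + 1, j) < entry T (i, j + 1))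
      then jdt_slide (exchange T (i, j) (i + 1, j)) (i + 1) j
      else if (i, j + 1) \<in> boxes T
      then jdt_slide (exchange T (i, j) (i, j + 1)) i (j + 1)
      else delete_corner T i)"
  by auto

lemma box_column_bound:
  assumes "(i, j) \<in> boxes T"
  shows "j < sum_list (map length T)"
proof -
  have "length (T ! i) \<in> set (map length T)" using assms by (auto simp: boxes_def)
  then have "length (T ! i) \<le> sum_list (map length T)" by (simp add: member_le_sum_list)
  then show ?thesis using assms by (simp add: boxes_def)
qed

termination
proof (relation "Wellfounded.measure (\<lambda>(T, i, j). (length T - i) + (sum_list (map length T) - j))",
    goal_cases)
  case 1
  show ?case by simp
next
  case (2 T i j)
  then have "i + 1 < length T" by (simp add: boxes_def)
  then show ?case by simp
next
  case (3 T i j)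
  then have "j + 1 < sum_list (map length T)" by (blast dest: box_column_bound)
  then show ?case by simp
qed

declare jdt_slide.simps [simp del]

definition jdt_delete :: "nat \<Rightarrow> tableau \<Rightarrow> tableau" where
  "jdt_delete x T = (case box_of T x of (i, j) \<Rightarrow> jdt_slide T i j)"

fun row_insert :: "nat \<Rightarrow> tableau \<Rightarrow> tableau" where
  "row_insert x [] = [[x]]"
| "row_insert x (R # T) =
     (if \<exists>y\<in>set R. x < y
      then (let y = Min {y \<in> set R. x < y}
            in map (\<lambda>z. if z = y then x else z) R # row_insert y T)
      else (R @ [x]) # T)"

section \<open>Insertion map\<close>

text \<open>
  \<open>insertion_tableau k d n\<close> is $T^{(n/2)}$ and \<open>insertion_shape k d n\<close> is $\lambda^{(n/2)}$, for
  \<open>0 \<le> n \<le> 4 * k\<close>.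
\<close>

fun insertion_tableau :: "nat \<Rightarrow> vertex set set \<Rightarrow> nat \<Rightarrow> tableau" where
  "insertion_tableau k d 0 = []"
| "insertion_tableau k d (Suc n) =
     (case insertion_seq k d (Suc n) of
        None \<Rightarrow> insertion_tableau k d n
      | Some a \<Rightarrow>
          if odd (Suc n) then jdt_delete a (insertion_tableau k d n)
          else row_insert a (insertion_tableau k d n))"

definition shape :: "tableau \<Rightarrow> nat list" where
  "shape T = map length T"

definition insertion_shape :: "nat \<Rightarrow> vertex set set \<Rightarrow> nat \<Rightarrow> nat list" where
  "insertion_shape k d n = shape (insertion_tableau k d n)"

definition num_parts :: "nat list \<Rightarrow> nat" where
  "num_parts \<mu> = length (filter (\<lambda>p. p \<noteq> 0) \<mu>)"

end

theory Submission
  imports Defs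
begin

text \<open>
  Both conditions say that no two edges of the standard representation cross.

  As long as no crossing edge has been opened, the tableau is a single row containing the labels
  of the open edges: a noncrossing edge closes before every open edge, so its label is the largest
  and is appended, and the edge closed next carries the last entry. The first edge that crosses an
  open one bumps an entry into a second row.

  A noncrossing standard representation is drawn by straight chords between points in convex
  position, which a homeomorphism carries to the rectangle. Conversely, in a planar drawing two
  crossing edges would give disjoint paths between interlaced boundary points, against the
  Fashoda meet theorem.
\<close>

section \<open>The standard representation\<close>

text \<open>The inequalities are strict, so nested edges and edges sharing an endpoint are allowed;
  quantifying over ordered pairs covers both roles of the two edges.\<close>

definition noncrossing :: "(nat \<times> nat) set \<Rightarrow> bool" where
  "noncrossing E \<longleftrightarrow>
     (\<forall>i j i' j'. (i, j) \<in> E \<longrightarrow> (i', j') \<in> E \<longrightarrow> \<not> (i < i' \<and> i' < j \<and> j < j'))"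

section \<open>Relabelled vertices and uniqueness of standard edges\<close>

lemma bij_betw_relabel: "bij_betw (relabel k) (vertices k) {1..2 * k}"
proof (rule bij_betw_imageI)
  show "inj_on (relabel k) (vertices k)"
    by (auto simp: inj_on_def vertices_def)
  show "relabel k ` vertices k = {1..2 * k}"
  proof
    show "relabel k ` vertices k \<subseteq> {1..2 * k}" by (auto simp: vertices_def)
    show "{1..2 * k} \<subseteq> relabel k ` vertices k"
    proof
      fix m assume m: "m \<in> {1..2 * k}"
      show "m \<in> relabel k ` vertices k"
      proof (cases "m \<le> k")
        case True
        with m show ?thesis by (intro image_eqI[where x = "Top m"]) (auto simp: vertices_def)
      next
        case False
        with m show ?thesis
          by (intro image_eqI[where x = "Bot (2 * k + 1 - m)"])
            (auto simp: vertices_def intro!: disjI2 imageI)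
      qed
    qed
  qed
qed

lemma block_subset: "d \<in> partitions k \<Longrightarrow> B \<in> d \<Longrightarrow> B \<subseteq> vertices k"
  by (auto simp: partitions_def partition_on_def)

lemma block_eq:
  assumes "d \<in> partitions k" "B \<in> d" "B' \<in> d" "u \<in> B" "u \<in> B'"
  shows "B = B'"
  using assms by (auto simp: partitions_def partition_on_def disjoint_def)

lemma block_eq_relabel:
  assumes d: "d \<in> partitions k" and B: "B \<in> d" "B' \<in> d"
    and m: "m \<in> relabel k ` B" "m \<in> relabel k ` B'"
  shows "B = B'"
proof -
  obtain u v where uv: "u \<in> B" "m = relabel k u" "v \<in> B'" "m = relabel k v" using m by blast
  have "u = v"
    using bij_betw_relabel[of k] block_subset[OF d B(1)] block_subset[OF d B(2)] uv
    by (metis bij_betw_imp_inj_on inj_onD subsetD)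
  then show ?thesis using block_eq[OF d B] uv by blast
qed

lemma std_edges_bounds:
  assumes "d \<in> partitions k" "(i, j) \<in> std_edges k d"
  shows "1 \<le> i" "i < j" "j \<le> 2 * k"
proof -
  obtain B where B: "B \<in> d" "i \<in> relabel k ` B" "j \<in> relabel k ` B" "i < j"
    using assms(2) by (auto simp: std_edges_def)
  have "relabel k ` B \<subseteq> {1..2 * k}"
    using block_subset[OF assms(1) B(1)] bij_betw_relabel[of k] by (auto simp: bij_betw_def)
  with B show "1 \<le> i" "i < j" "j \<le> 2 * k" by auto
qed

text \<open>A standard edge joins \<open>i\<close> to its successor in the block, and
  \<open>i\<close> determines the block. Dually, \<open>j\<close> determines its
  predecessor.\<close>

lemma std_edges_right_unique:
  assumes d: "d \<in> partitions k" and e: "(i, j) \<in> std_edges k d" "(i, j') \<in> std_edges k d"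
  shows "j = j'"
proof -
  obtain B where B: "B \<in> d" "i \<in> relabel k ` B" "j \<in> relabel k ` B" "i < j"
      "\<forall>m. i < m \<and> m < j \<longrightarrow> m \<notin> relabel k ` B"
    using e(1) unfolding std_edges_def by blast
  obtain B' where B': "B' \<in> d" "i \<in> relabel k ` B'" "j' \<in> relabel k ` B'" "i < j'"
      "\<forall>m. i < m \<and> m < j' \<longrightarrow> m \<notin> relabel k ` B'"
    using e(2) unfolding std_edges_def by blast
  have "B = B'" using block_eq_relabel[OF d B(1) B'(1) B(2) B'(2)] .
  with B B' show ?thesis by (metis nat_neq_iff)
qed

lemma std_edges_left_unique:
  assumes d: "d \<in> partitions k" and e: "(i, j) \<in> std_edges k d" "(i', j) \<in> std_edges k d"
  shows "i = i'"
proof -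
  obtain B where B: "B \<in> d" "i \<in> relabel k ` B" "j \<in> relabel k ` B" "i < j"
      "\<forall>m. i < m \<and> m < j \<longrightarrow> m \<notin> relabel k ` B"
    using e(1) unfolding std_edges_def by blast
  obtain B' where B': "B' \<in> d" "i' \<in> relabel k ` B'" "j \<in> relabel k ` B'" "i' < j"
      "\<forall>m. i' < m \<and> m < j \<longrightarrow> m \<notin> relabel k ` B'"
    using e(2) unfolding std_edges_def by blast
  have "B = B'" using block_eq_relabel[OF d B(1) B'(1) B(3) B'(3)] .
  with B B' show ?thesis by (metis nat_neq_iff)
qed

section \<open>Values of the insertion sequence\<close>

lemma label_if_edge_singleton: "label_if_edge k {e} = Some (edge_label k e)"
  by (simp add: label_if_edge_def)

text \<open>Uniqueness of the right endpoint makes the set under \<open>THE\<close> a singleton, so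
  the description picks the intended edge.\<close>

lemma insertion_seq_even:
  assumes "d \<in> partitions k" "(i, j) \<in> std_edges k d"
  shows "insertion_seq k d (2 * i) = Some (2 * k + 1 - j)"
proof -
  have "{e \<in> std_edges k d. fst e = i} = {(i, j)}"
    using assms std_edges_right_unique by fastforce
  then show ?thesis by (simp add: insertion_seq_def label_if_edge_singleton)
qed

text \<open>The index is fixed by \<open>n + 1 = 2 * j\<close> rather than
  \<open>n = 2 * j - 1\<close> to stay clear of truncated subtraction.\<close>

lemma insertion_seq_odd:
  assumes "d \<in> partitions k" "(i, j) \<in> std_edges k d" "n + 1 = 2 * j"
  shows "insertion_seq k d n = Some (2 * k + 1 - j)"
proof -
  have "{e \<in> std_edges k d. snd e = (n + 1) div 2} = {(i, j)}"
    using assms std_edges_left_unique by fastforce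
  moreover have "odd n" using assms(3) by presburger
  ultimately show ?thesis by (simp add: insertion_seq_def label_if_edge_singleton)
qed

lemma insertion_seq_even_None:
  assumes "\<nexists>j. (i, j) \<in> std_edges k d"
  shows "insertion_seq k d (2 * i) = None"
proof -
  have "{e \<in> std_edges k d. fst e = i} = {}" using assms by auto
  then show ?thesis by (simp add: insertion_seq_def label_if_edge_def)
qed

lemma insertion_seq_odd_None:
  assumes "\<nexists>i. (i, j) \<in> std_edges k d" "n + 1 = 2 * j"
  shows "insertion_seq k d n = None"
proof -
  have "{e \<in> std_edges k d. snd e = (n + 1) div 2} = {}" using assms by auto
  moreover have "odd n" using assms(2) by presburger
  ultimately show ?thesis by (simp add: insertion_seq_def label_if_edge_def)
qed

text \<open>Inverse of \<open>relabel k\<close> on \<open>{1..2 * k}\<close>; it turns standard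
  edges back into edges between vertices.\<close>

definition vtx :: "nat \<Rightarrow> nat \<Rightarrow> vertex" where
  "vtx k m = (if m \<le> k then Top m else Bot (2 * k + 1 - m))"

lemma vtx_relabel: "v \<in> vertices k \<Longrightarrow> vtx k (relabel k v) = v"
  by (auto simp: vertices_def vtx_def)

lemma relabel_vtx: "1 \<le> m \<Longrightarrow> m \<le> 2 * k \<Longrightarrow> relabel k (vtx k m) = m"
  by (auto simp: vtx_def)

lemma vtx_in_vertices: "1 \<le> m \<Longrightarrow> m \<le> 2 * k \<Longrightarrow> vtx k m \<in> vertices k"
  by (auto simp: vertices_def vtx_def intro!: disjI2 imageI)

lemma vertices_eq_vtx: "vertices k = vtx k ` {1..2 * k}"
proof
  show "vertices k \<subseteq> vtx k ` {1..2 * k}"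
  proof
    fix v assume v: "v \<in> vertices k"
    then have "relabel k v \<in> {1..2 * k}" using bij_betw_relabel bij_betwE by blast
    then have "vtx k (relabel k v) \<in> vtx k ` {1..2 * k}" by (rule imageI)
    then show "v \<in> vtx k ` {1..2 * k}" by (simp only: vtx_relabel[OF v])
  qed
  show "vtx k ` {1..2 * k} \<subseteq> vertices k" using vtx_in_vertices by auto
qed

section \<open>One-row tableaux\<close>

text \<open>The empty set gives \<open>[]\<close> and not \<open>[[]]\<close>, in line with the
  initial tableau and with \<open>delete_corner\<close>, which drops empty rows.\<close>

definition one_row :: "nat set \<Rightarrow> tableau" where
  "one_row S = (if S = {} then [] else [sorted_list_of_set S])"

lemma num_parts_one_row: "num_parts (shape (one_row S)) \<le> 1"
  by (simp add: one_row_def shape_def num_parts_def)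

lemma one_row_insert:
  fixes a :: nat
  assumes "finite S" "\<forall>x\<in>S. x < a"
  shows "one_row (insert a S) = [sorted_list_of_set S @ [a]]"
proof -
  have "a \<notin> S" using assms(2) by blast
  then have "sorted_list_of_set (insert a S) = insort a (sorted_list_of_set S)"
    using assms(1) by simp
  also have "\<dots> = sorted_list_of_set S @ [a]"
    using assms by (intro sorted_insort_is_snoc) (auto intro: less_imp_le)
  finally show ?thesis unfolding one_row_def by (simp only: insert_not_empty if_False)
qed

lemma row_insert_one_row:
  assumes "finite S" "\<forall>x\<in>S. x < a"
  shows "row_insert a (one_row S) = one_row (insert a S)"
proof -
  have "\<not> (\<exists>y\<in>S. a < y)" using assms(2) by (meson not_less_iff_gr_or_eq)
  then show ?thesis
    unfolding one_row_insert[OF assms] using assms(1) by (simp add: one_row_def)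
qed

text \<open>The bumped entry meets no second row and founds one. The first row is nonempty, so both
  rows count as parts.\<close>

lemma num_parts_row_insert_one_row:
  assumes "finite S" "y \<in> S" "a < y"
  shows "num_parts (shape (row_insert a (one_row S))) = 2"
proof -
  have "S \<noteq> {}" "\<exists>y\<in>S. a < y" "card S \<noteq> 0" using assms by auto
  then show ?thesis
    using assms(1) by (simp add: one_row_def shape_def num_parts_def Let_def)
qed

text \<open>The largest entry sits in the last box, which is already a corner, so nothing slides. If
  \<open>S\<close> is empty, the emptied row disappears.\<close>

lemma jdt_delete_one_row:
  assumes S: "finite S" "\<forall>x\<in>S. x < a"
  shows "jdt_delete a (one_row (insert a S)) = one_row S"
proof -
  define xs where "xs = sorted_list_of_set S"
  have xs: "a \<notin> set xs" "xs = [] \<longleftrightarrow> S = {}" using S by (auto simp: xs_def)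
  have T: "one_row (insert a S) = [xs @ [a]]"
    unfolding xs_def by (rule one_row_insert[OF S])
  have "box_of [xs @ [a]] a = (0, length xs)"
    unfolding box_of_def
  proof (rule the_equality)
    show "(0, length xs) \<in> boxes [xs @ [a]] \<and> entry [xs @ [a]] (0, length xs) = a"
      by (simp add: boxes_def)
  next
    fix b assume "b \<in> boxes [xs @ [a]] \<and> entry [xs @ [a]] b = a"
    then obtain j where "b = (0, j)" "j < Suc (length xs)" "(xs @ [a]) ! j = a"
      by (auto simp: boxes_def)
    then show "b = (0, length xs)"
      using xs(1) by (metis less_antisym nth_append nth_mem)
  qed
  then have "jdt_delete a [xs @ [a]] = delete_corner [xs @ [a]] 0"
    by (simp add: jdt_delete_def jdt_slide.simps boxes_def)
  also have "\<dots> = one_row S"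
    using xs(2) by (simp add: delete_corner_def one_row_def xs_def)
  finally show ?thesis by (simp add: T)
qed

text \<open>The doubled time \<open>n\<close> lies in \<open>[2 * i, 2 * j - 1)\<close> exactly while the edge \<open>(i, j)\<close> is open.\<close>

definition open_labels :: "nat \<Rightarrow> vertex set set \<Rightarrow> nat \<Rightarrow> nat set" where
  "open_labels k d n =
     {2 * k + 1 - j | i j. (i, j) \<in> std_edges k d \<and> 2 * i \<le> n \<and> n + 1 < 2 * j}"

section \<open>Evolution of the tableau\<close>

lemma finite_open_labels: "finite (open_labels k d n)"
  by (rule finite_subset[of _ "{..2 * k + 1}"]) (auto simp: open_labels_def)

text \<open>Crossings are excluded only for the edge that opens at this very step. This local form
  serves both a noncrossing representation and the induction in which the bound on the shapes rules
  out crossings one step at a time.\<close>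

lemma insertion_tableau_Suc:
  assumes d: "d \<in> partitions k"
    and T: "insertion_tableau k d n = one_row (open_labels k d n)"
    and nc: "\<And>i j i' j'. (i', j') \<in> std_edges k d \<Longrightarrow> (i, j) \<in> std_edges k d \<Longrightarrow>
      Suc n = 2 * i \<Longrightarrow> \<not> (i' < i \<and> i < j' \<and> j' < j)"
  shows "insertion_tableau k d (Suc n) = one_row (open_labels k d (Suc n))"
proof (cases "odd n")
  case True
  \<comment> \<open>\<open>Suc n\<close> is even, so the only possible change is the opening of an
    edge at vertex \<open>i\<close>.\<close>
  then obtain i where i: "Suc n = 2 * i" by (metis dvdE even_Suc)
  show ?thesis
  proof (cases "\<exists>j. (i, j) \<in> std_edges k d")
    case False
    have "2 * i' \<le> Suc n \<and> Suc n + 1 < 2 * j' \<longleftrightarrow> 2 * i' \<le> n \<and> n + 1 < 2 * j'"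
      if "(i', j') \<in> std_edges k d" for i' j'
    proof -
      have "i' \<noteq> i" using that False by blast
      then show ?thesis using i by presburger
    qed
    then have "open_labels k d (Suc n) = open_labels k d n"
      unfolding open_labels_def by blast
    moreover have "insertion_seq k d (Suc n) = None"
      unfolding i by (rule insertion_seq_even_None[OF False])
    ultimately show ?thesis using T by simp
  next
    case ex: True
    then obtain j where j: "(i, j) \<in> std_edges k d" by blast
    note bj = std_edges_bounds[OF d j]
    have L: "open_labels k d (Suc n) = insert (2 * k + 1 - j) (open_labels k d n)"
    proof (intro set_eqI iffI)
      fix x assume "x \<in> open_labels k d (Suc n)"
      then obtain i' j' where x: "x = 2 * k + 1 - j'" "(i', j') \<in> std_edges k d"
          "2 * i' \<le> Suc n" "Suc n + 1 < 2 * j'"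
        unfolding open_labels_def by blast
      show "x \<in> insert (2 * k + 1 - j) (open_labels k d n)"
      proof (cases "i' = i")
        case True
        then show ?thesis using std_edges_right_unique[OF d j] x by blast
      next
        case False
        then have "2 * i' \<le> n" "n + 1 < 2 * j'" using i x by auto
        then show ?thesis unfolding open_labels_def using x by blast
      qed
    next
      fix x assume "x \<in> insert (2 * k + 1 - j) (open_labels k d n)"
      then consider "x = 2 * k + 1 - j" | "x \<in> open_labels k d n" by blast
      then show "x \<in> open_labels k d (Suc n)"
      proof cases
        case 1
        moreover have "2 * i \<le> Suc n" "Suc n + 1 < 2 * j" using i bj by auto
        ultimately show ?thesis unfolding open_labels_def using j by blast
      next
        case 2
        then obtain i' j' where x: "x = 2 * k + 1 - j'" "(i', j') \<in> std_edges k d"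
            "2 * i' \<le> n" "n + 1 < 2 * j'"
          unfolding open_labels_def by blast
        then have "2 * i' \<le> Suc n" "Suc n + 1 < 2 * j'" using i by presburger+
        then show ?thesis unfolding open_labels_def using x by blast
      qed
    qed
    \<comment> \<open>Labels reverse the order of right endpoints. An open edge cannot end at
      \<open>j\<close> by uniqueness, nor before \<open>j\<close> by \<open>nc\<close>, so its label
      is smaller than the new one.\<close>
    have "\<forall>x\<in>open_labels k d n. x < 2 * k + 1 - j"
    proof
      fix x assume "x \<in> open_labels k d n"
      then obtain i' j' where x: "x = 2 * k + 1 - j'" "(i', j') \<in> std_edges k d"
          "2 * i' \<le> n" "n + 1 < 2 * j'"
        unfolding open_labels_def by blast
      then have "i' < i" "i < j'" using i by auto
      moreover have "j' \<noteq> j" using std_edges_left_unique[OF d j] x(2) \<open>i' < i\<close> by blast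
      ultimately have "j < j'" using nc[OF x(2) j i] by auto
      then show "x < 2 * k + 1 - j" using x(1) bj std_edges_bounds[OF d x(2)] by auto
    qed
    then have "row_insert (2 * k + 1 - j) (one_row (open_labels k d n))
        = one_row (open_labels k d (Suc n))"
      using row_insert_one_row[OF finite_open_labels] L by simp
    moreover have "insertion_seq k d (Suc n) = Some (2 * k + 1 - j)"
      unfolding i by (rule insertion_seq_even[OF d j])
    ultimately show ?thesis using True T by simp
  qed
next
  case False
  \<comment> \<open>\<open>Suc n\<close> is odd, so the only possible change is the closing of an
    edge at vertex \<open>j\<close>.\<close>
  then obtain j where j: "Suc n + 1 = 2 * j" by (metis Suc_eq_plus1 dvdE even_Suc)
  show ?thesis
  proof (cases "\<exists>i. (i, j) \<in> std_edges k d")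
    case none: False
    have "2 * i' \<le> Suc n \<and> Suc n + 1 < 2 * j' \<longleftrightarrow> 2 * i' \<le> n \<and> n + 1 < 2 * j'"
      if "(i', j') \<in> std_edges k d" for i' j'
    proof -
      have "j' \<noteq> j" using that none by blast
      then show ?thesis using j by presburger
    qed
    then have "open_labels k d (Suc n) = open_labels k d n"
      unfolding open_labels_def by blast
    then show ?thesis using insertion_seq_odd_None[OF none j] T by simp
  next
    case ex: True
    then obtain i where i: "(i, j) \<in> std_edges k d" by blast
    note bi = std_edges_bounds[OF d i]
    \<comment> \<open>Stated as an insertion into the later set, which is the form
      \<open>jdt_delete_one_row\<close> expects.\<close>
    have L: "open_labels k d n = insert (2 * k + 1 - j) (open_labels k d (Suc n))"
    proof (intro set_eqI iffI)
      fix x assume "x \<in> open_labels k d n"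
      then obtain i' j' where x: "x = 2 * k + 1 - j'" "(i', j') \<in> std_edges k d"
          "2 * i' \<le> n" "n + 1 < 2 * j'"
        unfolding open_labels_def by blast
      show "x \<in> insert (2 * k + 1 - j) (open_labels k d (Suc n))"
      proof (cases "j' = j")
        case True
        then show ?thesis using x by blast
      next
        case False
        then have "2 * i' \<le> Suc n" "Suc n + 1 < 2 * j'" using j x by presburger+
        then show ?thesis unfolding open_labels_def using x by blast
      qed
    next
      fix x assume "x \<in> insert (2 * k + 1 - j) (open_labels k d (Suc n))"
      then consider "x = 2 * k + 1 - j" | "x \<in> open_labels k d (Suc n)" by blast
      then show "x \<in> open_labels k d n"
      proof cases
        case 1
        moreover have "2 * i \<le> n" "n + 1 < 2 * j" using j bi by auto
        ultimately show ?thesis unfolding open_labels_def using i by blast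
      next
        case 2
        then obtain i' j' where x: "x = 2 * k + 1 - j'" "(i', j') \<in> std_edges k d"
            "2 * i' \<le> Suc n" "Suc n + 1 < 2 * j'"
          unfolding open_labels_def by blast
        then have "2 * i' \<le> n" "n + 1 < 2 * j'" using j by presburger+
        then show ?thesis unfolding open_labels_def using x by blast
      qed
    qed
    \<comment> \<open>Every edge still open ends to the right of \<open>j\<close>, so the closing
      label exceeds all others.\<close>
    have "\<forall>x\<in>open_labels k d (Suc n). x < 2 * k + 1 - j"
    proof
      fix x assume "x \<in> open_labels k d (Suc n)"
      then obtain i' j' where x: "x = 2 * k + 1 - j'" "(i', j') \<in> std_edges k d"
          "Suc n + 1 < 2 * j'"
        unfolding open_labels_def by blast
      then show "x < 2 * k + 1 - j" using j bi std_edges_bounds[OF d x(2)] by auto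
    qed
    then have "jdt_delete (2 * k + 1 - j) (one_row (open_labels k d n))
        = one_row (open_labels k d (Suc n))"
      using jdt_delete_one_row[OF finite_open_labels] L by simp
    then show ?thesis using insertion_seq_odd[OF d i j] False T by simp
  qed
qed

text \<open>When \<open>(i, j)\<close> opens, \<open>(i', j')\<close> is still open, and its label
  is larger because \<open>j' < j\<close>; the new label therefore bumps.\<close>

lemma num_parts_crossing:
  assumes d: "d \<in> partitions k"
    and e: "(i', j') \<in> std_edges k d" "(i, j) \<in> std_edges k d" "i' < i" "i < j'" "j' < j"
    and T: "insertion_tableau k d (2 * i - 1) = one_row (open_labels k d (2 * i - 1))"
  shows "num_parts (insertion_shape k d (2 * i)) = 2"
proof -
  have b: "j \<le> 2 * k" using std_edges_bounds[OF d e(2)] by simp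
  obtain n where n: "2 * i = Suc n" using e(3) by (metis Suc_pred mult_pos_pos not_less_zero neq0_conv zero_less_numeral)
  then have n': "2 * i - 1 = n" and odd: "odd n" by presburger+
  have "2 * i' \<le> n" "n + 1 < 2 * j'" using e n by auto
  then have y: "2 * k + 1 - j' \<in> open_labels k d n"
    unfolding open_labels_def using e(1) by blast
  have "insertion_tableau k d (2 * i) = row_insert (2 * k + 1 - j) (one_row (open_labels k d n))"
    using insertion_seq_even[OF d e(2)] odd T unfolding n n' by simp
  then show ?thesis
    unfolding insertion_shape_def
    using num_parts_row_insert_one_row[OF finite_open_labels y] b e(5) by simp
qed

lemma insertion_tableau_0:
  assumes "d \<in> partitions k"
  shows "insertion_tableau k d 0 = one_row (open_labels k d 0)"
proof -
  have "open_labels k d 0 = {}" using std_edges_bounds[OF assms] by (force simp: open_labels_def)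
  then show ?thesis by (simp add: one_row_def)
qed

lemma noncrossing_iff_num_parts:
  assumes d: "d \<in> partitions k"
  shows "noncrossing (std_edges k d) \<longleftrightarrow>
    (\<forall>n\<in>{0..4 * k}. num_parts (insertion_shape k d n) \<le> 1)"
proof
  assume nc: "noncrossing (std_edges k d)"
  have "insertion_tableau k d n = one_row (open_labels k d n)" for n
  proof (induction n)
    case 0
    show ?case using insertion_tableau_0[OF d] .
  next
    case (Suc n)
    show ?case
      using nc by (intro insertion_tableau_Suc[OF d Suc]) (auto simp: noncrossing_def)
  qed
  then show "\<forall>n\<in>{0..4 * k}. num_parts (insertion_shape k d n) \<le> 1"
    using num_parts_one_row by (simp add: insertion_shape_def)
next
  assume np: "\<forall>n\<in>{0..4 * k}. num_parts (insertion_shape k d n) \<le> 1"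
  have T: "insertion_tableau k d n = one_row (open_labels k d n)" if "n \<le> 4 * k" for n
    using that
  proof (induction n)
    case 0
    show ?case using insertion_tableau_0[OF d] .
  next
    case (Suc n)
    then have IH: "insertion_tableau k d n = one_row (open_labels k d n)" by simp
    show ?case
    proof (rule insertion_tableau_Suc[OF d IH], rule notI)
      \<comment> \<open>A crossing at this step would produce a shape with two parts, against the
        bound at time \<open>2 * i\<close>.\<close>
      fix i j i' j'
      assume e: "(i', j') \<in> std_edges k d" "(i, j) \<in> std_edges k d" and i: "Suc n = 2 * i"
        and c: "i' < i \<and> i < j' \<and> j' < j"
      have "2 * i - 1 = n" using i by simp
      then have "num_parts (insertion_shape k d (2 * i)) = 2"
        using num_parts_crossing[OF d e] c IH by simp
      moreover have "2 * i \<in> {0..4 * k}" using Suc.prems i by simp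
      ultimately show False using np by fastforce
    qed
  qed
  show "noncrossing (std_edges k d)"
    unfolding noncrossing_def
  proof (intro allI impI notI)
    fix i' j' i j
    assume e: "(i', j') \<in> std_edges k d" "(i, j) \<in> std_edges k d"
      and c: "i' < i \<and> i < j' \<and> j' < j"
    \<comment> \<open>The tableau just before time \<open>2 * i\<close> is a single row, so opening
      the later edge already violates the bound.\<close>
    have "i \<le> 2 * k" using std_edges_bounds[OF d e(2)] by simp
    then have "2 * i - 1 \<le> 4 * k" "2 * i \<in> {0..4 * k}" by auto
    then show False
      using num_parts_crossing[OF d e] c T np by fastforce
  qed
qed

section \<open>Drawing noncrossing partitions\<close>

text \<open>Twice the signed area of the triangle \<open>p q r\<close>, positive when it is
  traversed counterclockwise.\<close>

definition orient :: "real \<times> real \<Rightarrow> real \<times> real \<Rightarrow> real \<times> real \<Rightarrow> real" where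
  "orient p q r = (fst q - fst p) * (snd r - snd p) - (snd q - snd p) * (fst r - fst p)"

lemma orient_swap: "orient p r q = - orient p q r"
  by (simp add: orient_def algebra_simps)

lemma orient_rotate: "orient q r p = orient p q r"
  by (simp add: orient_def algebra_simps)

lemma orient_degenerate [simp]: "orient p q p = 0" "orient p q q = 0"
  by (simp_all add: orient_def)

lemma orient_affine:
  "orient p q ((1 - t) *\<^sub>R r + t *\<^sub>R s) = (1 - t) * orient p q r + t * orient p q s"
  by (simp add: orient_def algebra_simps)

lemma orient_closed_segment: "r \<in> closed_segment p q \<Longrightarrow> orient p q r = 0"
  by (auto simp: closed_segment_def orient_affine)

text \<open>
  The lens \<open>\<bar>y\<bar> \<le> lens_height k x\<close> is strictly convex above and below, so straight chords
  between the points \<open>lens_vertex k m\<close> cross only if their ends interlace. A vertical rescaling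
  turns the lens into the rectangle.
\<close>

definition lens_height :: "nat \<Rightarrow> real \<Rightarrow> real" where
  "lens_height k x = x * (real k + 1 - x)"

definition lens :: "nat \<Rightarrow> (real \<times> real) set" where
  "lens k = {p. 1 \<le> fst p \<and> fst p \<le> real k \<and> \<bar>snd p\<bar> \<le> lens_height k (fst p)}"

text \<open>Clockwise numbering, as in the relabelling: left to right along the upper arc, then
  right to left along the lower one.\<close>

definition lens_vertex :: "nat \<Rightarrow> nat \<Rightarrow> real \<times> real" where
  "lens_vertex k m =
     (if m \<le> k then (real m, lens_height k (real m))
      else (real (2 * k + 1 - m), - lens_height k (real (2 * k + 1 - m))))"

definition flatten_lens :: "nat \<Rightarrow> real \<times> real \<Rightarrow> real \<times> real" where
  "flatten_lens k p = (fst p, 1 / 2 + snd p / (2 * lens_height k (fst p)))"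

text \<open>The zeros \<open>0\<close> and \<open>k + 1\<close> of the parabola lie outside
  \<open>[1, k]\<close>, which makes the division in \<open>flatten_lens\<close> safe.\<close>

lemma lens_height_pos: "1 \<le> x \<Longrightarrow> x \<le> real k \<Longrightarrow> 0 < lens_height k x"
  by (simp add: lens_height_def)

text \<open>Up to sign, this is what remains of the orientation of two points with abscissae
  \<open>a\<close>, \<open>b\<close> on one arc and a point with abscissa \<open>c\<close> on the
  opposite arc, once the difference of \<open>a\<close> and \<open>b\<close> is factored
  out.\<close>

lemma orient_lens_aux:
  fixes a b c M :: real
  assumes "0 < a" "a < M" "0 < b" "b < M" "0 < c" "c < M"
  shows "0 < c * (M - c) + a * (M - a) + (M - a - b) * (c - a)"
proof -
  \<comment> \<open>Multiplication by \<open>M\<close> exposes a sum of positive products.\<close>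
  have "M * (c * (M - c) + a * (M - a) + (M - a - b) * (c - a))
      = M * (c * (M - c)) + (M - c) * (a * b) + c * ((M - a) * (M - b))"
    by (simp add: algebra_simps)
  also have "0 < \<dots>" using assms by (intro add_pos_pos mult_pos_pos) auto
  finally show ?thesis using assms by (simp add: zero_less_mult_iff)
qed

lemma orient_lens_vertex:
  assumes "1 \<le> i" "i < j" "j < l" "l \<le> 2 * k"
  shows "orient (lens_vertex k i) (lens_vertex k j) (lens_vertex k l) < 0"
proof -
  define M where "M = real k + 1"
  define x where "x m = (if m \<le> k then real m else real (2 * k + 1 - m))" for m
  have x: "0 < x m" "x m < M" if "1 \<le> m" "m \<le> 2 * k" for m
    using that by (auto simp: x_def M_def)
  have xi: "0 < x i" "x i < M" and xj: "0 < x j" "x j < M" and xl: "0 < x l" "x l < M"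
    using assms by (auto intro!: x)
  have v: "lens_vertex k m = (x m, (if m \<le> k then 1 else -1) * (x m * (M - x m)))" for m
    by (simp add: lens_vertex_def lens_height_def x_def M_def)
  \<comment> \<open>The cases have three, two, one or no vertices on the upper arc. Three points on
    one arc give a Vandermonde product; mixed triples use \<open>orient_lens_aux\<close>.\<close>
  consider "l \<le> k" | "j \<le> k" "k < l" | "i \<le> k" "k < j" | "k < i" by linarith
  then show ?thesis
  proof cases
    case 1
    then have "x i < x j" "x j < x l" using assms by (auto simp: x_def)
    then have "(x j - x i) * ((x l - x i) * (x l - x j)) > 0" by simp
    moreover have "orient (lens_vertex k i) (lens_vertex k j) (lens_vertex k l)
        = - ((x j - x i) * ((x l - x i) * (x l - x j)))"
      using 1 assms by (simp add: v orient_def algebra_simps)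
    ultimately show ?thesis by simp
  next
    case 2
    then have "x i < x j" using assms by (auto simp: x_def)
    then have "(x j - x i) * (x l * (M - x l) + x i * (M - x i) + (M - x i - x j) * (x l - x i)) > 0"
      using orient_lens_aux[OF xi xj xl] by simp
    moreover have "orient (lens_vertex k i) (lens_vertex k j) (lens_vertex k l)
        = - ((x j - x i) * (x l * (M - x l) + x i * (M - x i) + (M - x i - x j) * (x l - x i)))"
      using 2 assms by (simp add: v orient_def algebra_simps)
    ultimately show ?thesis by simp
  next
    case 3
    then have "x l < x j" using assms by (auto simp: x_def)
    then have "(x j - x l) * (x i * (M - x i) + x j * (M - x j) + (M - x j - x l) * (x i - x j)) > 0"
      using orient_lens_aux[OF xj xl xi] by simp
    moreover have "orient (lens_vertex k i) (lens_vertex k j) (lens_vertex k l)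
        = - ((x j - x l) * (x i * (M - x i) + x j * (M - x j) + (M - x j - x l) * (x i - x j)))"
      using 3 assms by (simp add: v orient_def algebra_simps)
    ultimately show ?thesis by simp
  next
    case 4
    then have "x l < x j" "x j < x i" using assms by (auto simp: x_def)
    then have "(x i - x j) * ((x i - x l) * (x j - x l)) > 0" by simp
    moreover have "orient (lens_vertex k i) (lens_vertex k j) (lens_vertex k l)
        = - ((x i - x j) * ((x i - x l) * (x j - x l)))"
      using 4 assms by (simp add: v orient_def algebra_simps)
    ultimately show ?thesis by simp
  qed
qed

text \<open>A chord separates the vertices outside \<open>[i, j]\<close> from those strictly between
  \<open>i\<close> and \<open>j\<close>, which the next lemma treats. For \<open>l < i\<close> the
  triple is rotated into increasing order.\<close>

lemma orient_chord_neg: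
  assumes "1 \<le> i" "i < j" "j \<le> 2 * k" "1 \<le> l" "l \<le> 2 * k" "l < i \<or> j < l"
  shows "orient (lens_vertex k i) (lens_vertex k j) (lens_vertex k l) < 0"
  using assms orient_lens_vertex[of i j l k] orient_lens_vertex[of l i j k]
    orient_rotate[of "lens_vertex k i" "lens_vertex k j" "lens_vertex k l"] by auto

lemma orient_chord_pos:
  assumes "1 \<le> i" "j \<le> 2 * k" "i < l" "l < j"
  shows "orient (lens_vertex k i) (lens_vertex k j) (lens_vertex k l) > 0"
  using assms orient_lens_vertex[of i l j k]
    orient_swap[of "lens_vertex k i" "lens_vertex k j" "lens_vertex k l"] by auto

lemma lens_vertex_on_chord:
  assumes "1 \<le> i" "i < j" "j \<le> 2 * k" "1 \<le> l" "l \<le> 2 * k"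
    and "lens_vertex k l \<in> closed_segment (lens_vertex k i) (lens_vertex k j)"
  shows "l = i \<or> l = j"
  using orient_closed_segment[OF assms(6)] orient_chord_neg[of i j k l] orient_chord_pos[of i j k l]
    assms by (metis less_irrefl linorder_neqE_nat)

text \<open>Two terms of one sign with sum zero both vanish. This confines a common point of two
  chords to an end of the second.\<close>

lemma zero_convex_combination:
  fixes a b t :: real
  assumes "(1 - t) * a + t * b = 0" "0 \<le> t" "t \<le> 1"
    and "(a \<le> 0 \<and> b \<le> 0) \<or> (0 \<le> a \<and> 0 \<le> b)" "a \<noteq> 0 \<or> b \<noteq> 0"
  shows "(a = 0 \<and> t = 0) \<or> (b = 0 \<and> t = 1)"
proof -
  have "(1 - t) * a = 0 \<and> t * b = 0"
    using assms(4)
  proof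
    assume "a \<le> 0 \<and> b \<le> 0"
    then show ?thesis
      using assms(1-3) add_nonpos_eq_0_iff[of "(1 - t) * a" "t * b"] by (simp add: mult_nonneg_nonpos)
  next
    assume "0 \<le> a \<and> 0 \<le> b"
    then show ?thesis
      using assms(1-3) add_nonneg_eq_0_iff[of "(1 - t) * a" "t * b"] by simp
  qed
  then show ?thesis using assms(5) by auto
qed

text \<open>Both ends of the second chord lie weakly on one side of the first. The orientation is
  affine along the second chord and vanishes at a common point, so that point is an end of
  both.\<close>

lemma noncrossing_chords:
  assumes i: "1 \<le> i" "i < j" "j \<le> 2 * k" and i': "1 \<le> i'" "i' < j'" "j' \<le> 2 * k"
    and ne: "(i, j) \<noteq> (i', j')"
    and nc: "\<not> (i < i' \<and> i' < j \<and> j < j')" "\<not> (i' < i \<and> i < j' \<and> j' < j)"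
  shows "closed_segment (lens_vertex k i) (lens_vertex k j) \<inter>
      closed_segment (lens_vertex k i') (lens_vertex k j') \<subseteq> lens_vertex k ` ({i, j} \<inter> {i', j'})"
proof
  let ?o = "\<lambda>l. orient (lens_vertex k i) (lens_vertex k j) (lens_vertex k l)"
  fix p
  assume p: "p \<in> closed_segment (lens_vertex k i) (lens_vertex k j) \<inter>
      closed_segment (lens_vertex k i') (lens_vertex k j')"
  then obtain t where t: "0 \<le> t" "t \<le> 1" "p = (1 - t) *\<^sub>R lens_vertex k i' + t *\<^sub>R lens_vertex k j'"
    by (auto simp: closed_segment_def)
  have zero: "?o l = 0 \<longleftrightarrow> l = i \<or> l = j" if "1 \<le> l" "l \<le> 2 * k" for l
    using orient_chord_neg[OF i that] orient_chord_pos[OF i(1,3), of l]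
    by (metis less_irrefl linorder_neqE_nat orient_degenerate)
  have neg: "?o l \<le> 0" if "1 \<le> l" "l \<le> 2 * k" "l \<le> i \<or> j \<le> l" for l
    using orient_chord_neg[OF i that(1,2)] zero[OF that(1,2)] that(3) by fastforce
  have pos: "?o l \<ge> 0" if "1 \<le> l" "l \<le> 2 * k" "i \<le> l \<and> l \<le> j" for l
    using orient_chord_pos[OF i(1,3), of l] zero[OF that(1,2)] that(3) by fastforce
  have b: "1 \<le> j'" "i' \<le> 2 * k" using i' by auto
  have "(1 - t) * ?o i' + t * ?o j' = 0"
    using orient_closed_segment p t(3) orient_affine by (metis IntD1)
  moreover have "(?o i' \<le> 0 \<and> ?o j' \<le> 0) \<or> (0 \<le> ?o i' \<and> 0 \<le> ?o j')"
  proof (cases "(i' \<le> i \<or> j \<le> i') \<and> (j' \<le> i \<or> j \<le> j')")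
    case True
    then show ?thesis using neg i' b by blast
  next
    case False
    \<comment> \<open>One end of the second chord lies strictly between \<open>i\<close> and
      \<open>j\<close>; noncrossing keeps the other within \<open>[i, j]\<close>.\<close>
    then have "i \<le> i' \<and> i' \<le> j \<and> i \<le> j' \<and> j' \<le> j" using nc i' by linarith
    then show ?thesis using pos i' b by blast
  qed
  \<comment> \<open>If both values vanished, both pairs would have the same ends in the same order,
    against \<open>ne\<close>.\<close>
  moreover have "?o i' \<noteq> 0 \<or> ?o j' \<noteq> 0" using zero ne i i' b by auto
  ultimately consider "?o i' = 0" "t = 0" | "?o j' = 0" "t = 1"
    using zero_convex_combination[of t "?o i'" "?o j'"] t by blast
  then show "p \<in> lens_vertex k ` ({i, j} \<inter> {i', j'})"
  proof cases
    case 1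
    then have "p = lens_vertex k i'" "i' = i \<or> i' = j" using t zero i' b by auto
    then show ?thesis by blast
  next
    case 2
    then have "p = lens_vertex k j'" "j' = i \<or> j' = j" using t zero i' b by auto
    then show ?thesis by blast
  qed
qed

section \<open>Convexity of the lens and its rescaling to the rectangle\<close>

lemma lens_height_concave:
  assumes "0 \<le> t" "t \<le> 1"
  shows "(1 - t) * lens_height k x + t * lens_height k y \<le> lens_height k ((1 - t) * x + t * y)"
proof -
  have "lens_height k ((1 - t) * x + t * y) - ((1 - t) * lens_height k x + t * lens_height k y)
      = t * (1 - t) * (x - y)\<^sup>2"
    by (simp add: lens_height_def algebra_simps power2_eq_square)
  also have "\<dots> \<ge> 0" using assms by simp
  finally show ?thesis by simp
qed

text \<open>Convexity keeps every chord inside the lens, where \<open>flatten_lens\<close> is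
  continuous and injective.\<close>

lemma convex_lens: "convex (lens k)"
  unfolding convex_alt
proof (intro ballI allI impI)
  fix p q and t :: real
  assume p: "p \<in> lens k" and q: "q \<in> lens k" and t: "0 \<le> t \<and> t \<le> 1"
  have "1 \<le> (1 - t) * fst p + t * fst q" "(1 - t) * fst p + t * fst q \<le> real k"
    using p q t convex_bound_le[of "fst p" "real k" "fst q" "1 - t" t]
      convex_bound_le[of "- fst p" "-1" "- fst q" "1 - t" t] by (auto simp: lens_def)
  moreover have "\<bar>(1 - t) * snd p + t * snd q\<bar> \<le> lens_height k ((1 - t) * fst p + t * fst q)"
  proof -
    have "\<bar>(1 - t) * snd p + t * snd q\<bar> \<le> (1 - t) * \<bar>snd p\<bar> + t * \<bar>snd q\<bar>"
      using t by (metis abs_mult abs_of_nonneg abs_triangle_ineq diff_ge_0_iff_ge)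
    also have "\<dots> \<le> (1 - t) * lens_height k (fst p) + t * lens_height k (fst q)"
      using p q t by (intro add_mono mult_left_mono) (auto simp: lens_def)
    also have "\<dots> \<le> lens_height k ((1 - t) * fst p + t * fst q)"
      using lens_height_concave t by blast
    finally show ?thesis .
  qed
  ultimately show "(1 - t) *\<^sub>R p + t *\<^sub>R q \<in> lens k" by (simp add: lens_def)
qed

lemma lens_vertex_in_lens:
  assumes "1 \<le> m" "m \<le> 2 * k"
  shows "lens_vertex k m \<in> lens k"
  using assms by (auto simp: lens_vertex_def lens_def less_imp_le[OF lens_height_pos])

lemma inj_on_flatten_lens: "inj_on (flatten_lens k) (lens k)"
proof (rule inj_onI)
  fix p q assume "p \<in> lens k" "q \<in> lens k" "flatten_lens k p = flatten_lens k q"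
  then show "p = q"
    using lens_height_pos[of "fst p" k] by (auto simp: flatten_lens_def lens_def prod_eq_iff)
qed

lemma continuous_on_flatten_lens: "continuous_on (lens k) (flatten_lens k)"
proof -
  have "lens_height k (fst p) \<noteq> 0" if "p \<in> lens k" for p
    using that lens_height_pos[of "fst p" k] by (auto simp: lens_def)
  then show ?thesis
    unfolding flatten_lens_def lens_height_def
    by (intro continuous_intros) (auto simp: lens_height_def)
qed

lemma flatten_lens_in_rectangle:
  assumes "p \<in> lens k"
  shows "flatten_lens k p \<in> rectangle k"
proof -
  have "0 < lens_height k (fst p)" "\<bar>snd p\<bar> \<le> lens_height k (fst p)"
    using assms lens_height_pos[of "fst p" k] by (auto simp: lens_def)
  then have "\<bar>snd p / (2 * lens_height k (fst p))\<bar> \<le> 1 / 2"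
    by (simp add: abs_mult field_simps)
  then have "0 \<le> 1 / 2 + snd p / (2 * lens_height k (fst p))"
      "1 / 2 + snd p / (2 * lens_height k (fst p)) \<le> 1"
    by linarith+
  then show ?thesis
    using assms by (simp add: flatten_lens_def rectangle_def cbox_Pair_eq lens_def)
qed

text \<open>On the two arcs the quotient in \<open>flatten_lens\<close> is \<open>1 / 2\<close> or
  \<open>- 1 / 2\<close>, which gives the heights \<open>1\<close> and \<open>0\<close>.\<close>

lemma flatten_lens_vertex:
  assumes "1 \<le> m" "m \<le> 2 * k"
  shows "flatten_lens k (lens_vertex k m) = position (vtx k m)"
proof -
  have "lens_height k (real m) \<noteq> 0" if "m \<le> k"
    using that assms lens_height_pos[of "real m" k] by simp
  moreover have "lens_height k (real (2 * k + 1 - m)) \<noteq> 0" if "\<not> m \<le> k"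
    using that assms lens_height_pos[of "real (2 * k + 1 - m)" k] by simp
  ultimately show ?thesis
    by (simp add: flatten_lens_def lens_vertex_def vtx_def del: of_nat_diff)
qed

lemma inj_on_lens_vertex: "inj_on (lens_vertex k) {1..2 * k}"
proof (rule inj_onI)
  fix m n assume m: "m \<in> {1..2 * k}" and n: "n \<in> {1..2 * k}"
    and "lens_vertex k m = lens_vertex k n"
  then have "position (vtx k m) = position (vtx k n)"
    using flatten_lens_vertex by (metis atLeastAtMost_iff)
  then have "vtx k m = vtx k n" by (cases "vtx k m"; cases "vtx k n") auto
  then show "m = n" using relabel_vtx m n by (metis atLeastAtMost_iff)
qed

section \<open>Drawing of the standard graph\<close>

lemma arc_continuous_image:
  assumes "arc g" "continuous_on (path_image g) f" "inj_on f (path_image g)"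
  shows "arc (f \<circ> g)"
  using assms by (simp add: arc_def path_continuous_image comp_inj_on path_image_def)

definition chord_arc :: "nat \<Rightarrow> nat \<times> nat \<Rightarrow> real \<Rightarrow> real \<times> real" where
  "chord_arc k e = flatten_lens k \<circ> linepath (lens_vertex k (fst e)) (lens_vertex k (snd e))"

definition std_graph :: "nat \<Rightarrow> vertex set set \<Rightarrow> vertex set set" where
  "std_graph k d = (\<lambda>(i, j). {vtx k i, vtx k j}) ` std_edges k d"

lemma std_edge_endpoints_in_block:
  assumes "d \<in> partitions k" "(i, j) \<in> std_edges k d"
  obtains B where "B \<in> d" "vtx k i \<in> B" "vtx k j \<in> B"
  using assms block_subset[OF assms(1)] vtx_relabel by (fastforce simp: std_edges_def)

text \<open>Standard edges never leave a block. Conversely, any two elements of a block are joined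
  by the chain of standard edges between consecutive elements.\<close>

lemma represents_std_graph:
  assumes d: "d \<in> partitions k"
  shows "represents k (std_graph k d) d"
proof -
  let ?R = "{(u, v). {u, v} \<in> std_graph k d}"
  have "graph_on (vertices k) (std_graph k d)"
    unfolding graph_on_def
  proof
    fix e assume "e \<in> std_graph k d"
    then obtain i j where e: "(i, j) \<in> std_edges k d" "e = {vtx k i, vtx k j}"
      by (auto simp: std_graph_def)
    note b = std_edges_bounds[OF d e(1)]
    have "vtx k i \<noteq> vtx k j" using relabel_vtx[of i k] relabel_vtx[of j k] b by auto
    then show "e \<subseteq> vertices k \<and> card e = 2" using b e(2) vtx_in_vertices by simp
  qed
  moreover have comp: "?R\<^sup>* `` {u} = B" if B: "B \<in> d" "u \<in> B" for u B
  proof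
    have "v \<in> B" if "(u, v) \<in> ?R\<^sup>*" for v
      using that
    proof induction
      case base
      show ?case by (rule B)
    next
      case (step y z)
      then obtain i j where e: "(i, j) \<in> std_edges k d" "{y, z} = {vtx k i, vtx k j}"
        by (auto simp: std_graph_def)
      obtain B' where "B' \<in> d" "{y, z} \<subseteq> B'"
        using std_edge_endpoints_in_block[OF d e(1)] e(2) by (metis empty_subsetI insert_subset)
      then show ?case using block_eq[OF d B(1), of B' y] step.IH by auto
    qed
    then show "?R\<^sup>* `` {u} \<subseteq> B" by auto
  next
    have sub: "B \<subseteq> vertices k" using block_subset[OF d B(1)] .
    have up: "(x, y) \<in> ?R\<^sup>*" if "x \<in> B" "y \<in> B" "relabel k x \<le> relabel k y" for x y
      using that
    proof (induction "relabel k y - relabel k x" arbitrary: x rule: less_induct)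
      case less
      show ?case
      proof (cases "relabel k x = relabel k y")
        case True
        then have "x = y" using less.prems sub vtx_relabel by (metis subsetD)
        then show ?thesis by simp
      next
        case False
        \<comment> \<open>The label of the successor of \<open>x\<close> in its block; the induction
          continues from there.\<close>
        define m where "m = (LEAST m. m \<in> relabel k ` B \<and> relabel k x < m)"
        have y: "relabel k y \<in> relabel k ` B \<and> relabel k x < relabel k y" using False less.prems by auto
        have m: "m \<in> relabel k ` B \<and> relabel k x < m"
          unfolding m_def by (rule LeastI) (rule y)
        have "m \<le> relabel k y" unfolding m_def by (rule Least_le) (rule y)
        have min: "\<forall>m'. relabel k x < m' \<and> m' < m \<longrightarrow> m' \<notin> relabel k ` B"
          unfolding m_def using not_less_Least by blast
        obtain z where z: "z \<in> B" "m = relabel k z" using m by blast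
        have "(relabel k x, m) \<in> std_edges k d"
          unfolding std_edges_def using B(1) less.prems(1) m min by blast
        then have "{vtx k (relabel k x), vtx k m} \<in> std_graph k d"
          by (force simp: std_graph_def)
        then have "(x, z) \<in> ?R" using z less.prems(1) sub vtx_relabel by (metis (no_types, lifting) case_prodI mem_Collect_eq subsetD)
        moreover have "(z, y) \<in> ?R\<^sup>*"
          using less.hyps[of z] z less.prems \<open>m \<le> relabel k y\<close> m by auto
        ultimately show ?thesis by (rule converse_rtrancl_into_rtrancl)
      qed
    qed
    have "sym ?R" by (auto simp: sym_def insert_commute)
    then have "sym (?R\<^sup>*)" by (rule sym_rtrancl)
    then have "(u, v) \<in> ?R\<^sup>*" if "v \<in> B" for v
      using up[OF B(2) that] up[OF that B(2)] by (meson linear symD)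
    then show "B \<subseteq> ?R\<^sup>* `` {u}" by auto
  qed
  have cov: "\<Union> d = vertices k" "{} \<notin> d" using d by (auto simp: partitions_def partition_on_def)
  have "vertices k // ?R\<^sup>* = d"
  proof (intro set_eqI iffI)
    fix C assume "C \<in> vertices k // ?R\<^sup>*"
    then obtain u where "u \<in> vertices k" "C = ?R\<^sup>* `` {u}" by (auto simp: quotient_def)
    then show "C \<in> d" using comp cov(1) by (metis UnionE)
  next
    fix C assume C: "C \<in> d"
    then obtain u where "u \<in> C" using cov(2) by (metis ex_in_conv)
    then have "u \<in> vertices k" "C = ?R\<^sup>* `` {u}" using comp[OF C] cov(1) C by blast+
    then show "C \<in> vertices k // ?R\<^sup>*" by (auto intro: quotientI)
  qed
  ultimately show ?thesis by (simp add: represents_def graph_components_def)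
qed

lemma noncrossing_imp_planar:
  assumes d: "d \<in> partitions k" and nc: "noncrossing (std_edges k d)"
  shows "planar k d"
proof -
  let ?G = "std_graph k d"
  let ?seg = "\<lambda>i j. closed_segment (lens_vertex k i) (lens_vertex k j)"
  \<comment> \<open>The drawing is indexed by unordered edges; \<open>Min\<close> and
    \<open>Max\<close> of the labels recover the ordered pair.\<close>
  define \<gamma> where "\<gamma> e = chord_arc k (Min (relabel k ` e), Max (relabel k ` e))" for e
  have \<gamma>: "\<gamma> {vtx k i, vtx k j} = chord_arc k (i, j)" if "(i, j) \<in> std_edges k d" for i j
    using std_edges_bounds[OF d that] by (simp add: \<gamma>_def relabel_vtx)
  have seg: "?seg i j \<subseteq> lens k" if "(i, j) \<in> std_edges k d" for i j
    using std_edges_bounds[OF d that]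
    by (intro closed_segment_subset convex_lens lens_vertex_in_lens) auto
  have img: "path_image (\<gamma> {vtx k i, vtx k j}) = flatten_lens k ` ?seg i j"
    if "(i, j) \<in> std_edges k d" for i j
    by (simp add: \<gamma>[OF that] chord_arc_def path_image_compose)
  have verts: "position ` vertices k = flatten_lens k ` lens_vertex k ` {1..2 * k}"
    unfolding vertices_eq_vtx image_image
    by (intro image_cong refl flatten_lens_vertex[symmetric]) auto
  have "arc (\<gamma> e) \<and> path_image (\<gamma> e) \<subseteq> rectangle k \<and>
        {pathstart (\<gamma> e), pathfinish (\<gamma> e)} = position ` e \<and>
        path_image (\<gamma> e) \<inter> position ` vertices k = position ` e" if "e \<in> ?G" for e
  proof -
    obtain i j where ij: "(i, j) \<in> std_edges k d" and e: "e = {vtx k i, vtx k j}"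
      using \<open>e \<in> ?G\<close> by (auto simp: std_graph_def)
    note b = std_edges_bounds[OF d ij]
    have pos: "position ` e = flatten_lens k ` lens_vertex k ` {i, j}"
      using b e by (simp add: flatten_lens_vertex)
    have "lens_vertex k i \<noteq> lens_vertex k j"
      using inj_on_lens_vertex[of k] b by (auto dest: inj_onD)
    then have "arc (linepath (lens_vertex k i) (lens_vertex k j))" by (rule arc_linepath)
    then have "arc (\<gamma> e)"
      unfolding e \<gamma>[OF ij] chord_arc_def fst_conv snd_conv
      using seg[OF ij] continuous_on_flatten_lens inj_on_flatten_lens
      by (intro arc_continuous_image) (auto intro: continuous_on_subset inj_on_subset)
    moreover have "path_image (\<gamma> e) \<subseteq> rectangle k"
      using seg[OF ij] flatten_lens_in_rectangle by (auto simp: e img[OF ij])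
    moreover have "{pathstart (\<gamma> e), pathfinish (\<gamma> e)} = position ` e"
      by (simp add: pos) (simp add: e \<gamma>[OF ij] chord_arc_def pathstart_compose pathfinish_compose)
    moreover have "path_image (\<gamma> e) \<inter> position ` vertices k = position ` e"
    proof -
      have "?seg i j \<inter> lens_vertex k ` {1..2 * k} = lens_vertex k ` {i, j}"
      proof
        show "?seg i j \<inter> lens_vertex k ` {1..2 * k} \<subseteq> lens_vertex k ` {i, j}"
          using lens_vertex_on_chord[OF b] by (blast dest: iffD1[OF atLeastAtMost_iff])
        show "lens_vertex k ` {i, j} \<subseteq> ?seg i j \<inter> lens_vertex k ` {1..2 * k}"
          using b by (auto simp del: One_nat_def intro!: imageI)
      qed
      \<comment> \<open>Injectivity of \<open>flatten_lens\<close> on the lens carries intersections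
        over from chords to arcs.\<close>
      moreover have "flatten_lens k ` ?seg i j \<inter> flatten_lens k ` lens_vertex k ` {1..2 * k}
          = flatten_lens k ` (?seg i j \<inter> lens_vertex k ` {1..2 * k})"
        using seg[OF ij] lens_vertex_in_lens[of _ k]
        by (intro inj_on_image_Int[OF inj_on_flatten_lens, symmetric]) auto
      ultimately show ?thesis unfolding verts pos unfolding e img[OF ij] by simp
    qed
    ultimately show ?thesis by blast
  qed
  moreover have "path_image (\<gamma> e) \<inter> path_image (\<gamma> e') = position ` (e \<inter> e')"
    if "e \<in> ?G" "e' \<in> ?G" "e \<noteq> e'" for e e'
  proof -
    obtain i j where ij: "(i, j) \<in> std_edges k d" and e: "e = {vtx k i, vtx k j}"
      using \<open>e \<in> ?G\<close> by (auto simp: std_graph_def)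
    obtain i' j' where ij': "(i', j') \<in> std_edges k d" and e': "e' = {vtx k i', vtx k j'}"
      using \<open>e' \<in> ?G\<close> by (auto simp: std_graph_def)
    note b = std_edges_bounds[OF d ij] and b' = std_edges_bounds[OF d ij']
    have ne: "(i, j) \<noteq> (i', j')" using that e e' by auto
    have nc': "\<not> (i < i' \<and> i' < j \<and> j < j')" "\<not> (i' < i \<and> i < j' \<and> j' < j)"
      using nc ij ij' unfolding noncrossing_def by blast+
    have "?seg i j \<inter> ?seg i' j' = lens_vertex k ` ({i, j} \<inter> {i', j'})"
    proof (rule equalityI)
      show "?seg i j \<inter> ?seg i' j' \<subseteq> lens_vertex k ` ({i, j} \<inter> {i', j'})"
        by (rule noncrossing_chords[OF b b' ne nc'])
    qed (auto simp: ends_in_segment)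
    moreover have "flatten_lens k ` ?seg i j \<inter> flatten_lens k ` ?seg i' j'
        = flatten_lens k ` (?seg i j \<inter> ?seg i' j')"
      using seg[OF ij] seg[OF ij'] by (intro inj_on_image_Int[OF inj_on_flatten_lens, symmetric])
    moreover have "position ` (e \<inter> e') = flatten_lens k ` lens_vertex k ` ({i, j} \<inter> {i', j'})"
    proof -
      have "inj_on (vtx k) {1..2 * k}"
        by (rule inj_on_inverseI[where g = "relabel k"]) (simp add: relabel_vtx)
      moreover have "{i, j} \<subseteq> {1..2 * k}" "{i', j'} \<subseteq> {1..2 * k}" using b b' by auto
      ultimately have "vtx k ` ({i, j} \<inter> {i', j'}) = vtx k ` {i, j} \<inter> vtx k ` {i', j'}"
        by (rule inj_on_image_Int)
      then have "e \<inter> e' = vtx k ` ({i, j} \<inter> {i', j'})" by (simp add: e e')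
      then have "position ` (e \<inter> e') = (\<lambda>m. position (vtx k m)) ` ({i, j} \<inter> {i', j'})"
        by (simp only: image_image)
      also have "\<dots> = (\<lambda>m. flatten_lens k (lens_vertex k m)) ` ({i, j} \<inter> {i', j'})"
        using b by (intro image_cong refl flatten_lens_vertex[symmetric]) auto
      finally show ?thesis by (simp add: image_image)
    qed
    ultimately show ?thesis by (simp add: e e' img[OF ij] img[OF ij'])
  qed
  ultimately have "plane_drawing k ?G \<gamma>" by (simp add: plane_drawing_def)
  then show ?thesis using represents_std_graph[OF d] by (auto simp: planar_def)
qed

section \<open>Drawings of crossing edges\<close>

text \<open>
  Continuous injection of the rectangle into the upper half-plane that unfolds its top and bottom
  sides into the real axis, so that the vertices appear in the order of their relabelling.
  It is \<open>(r * t, r * (1 - \<bar>t\<bar>))\<close> with \<open>r = k + 1 - x\<close> and \<open>t = 1 - 2 * y\<close>; one recovers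
  \<open>r\<close> as the \<open>\<ell>\<^sup>1\<close>-norm.
\<close>

definition unfold_rectangle :: "nat \<Rightarrow> real \<times> real \<Rightarrow> real ^ 2" where
  "unfold_rectangle k p =
     vector [(real k + 1 - fst p) * (1 - 2 * snd p),
             (real k + 1 - fst p) * (1 - \<bar>1 - 2 * snd p\<bar>)]"

lemma continuous_unfold_rectangle: "continuous_on S (unfold_rectangle k)"
proof -
  have "unfold_rectangle k = (\<lambda>p. \<chi> i. if i = 1 then (real k + 1 - fst p) * (1 - 2 * snd p)
      else (real k + 1 - fst p) * (1 - \<bar>1 - 2 * snd p\<bar>))"
    by (auto simp: unfold_rectangle_def vec_eq_iff forall_2)
  moreover have "continuous_on S (\<lambda>p. if i = 1 then (real k + 1 - fst p) * (1 - 2 * snd p)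
      else (real k + 1 - fst p) * (1 - \<bar>1 - 2 * snd p\<bar>))" for i :: 2
    by (cases "i = 1") (auto intro!: continuous_intros)
  ultimately show ?thesis by (simp add: continuous_on_vec_lambda)
qed

lemma inj_on_unfold_rectangle: "inj_on (unfold_rectangle k) (rectangle k)"
proof (rule inj_onI)
  fix p q assume p: "p \<in> rectangle k" and q: "q \<in> rectangle k"
    and eq: "unfold_rectangle k p = unfold_rectangle k q"
  obtain x y x' y' where [simp]: "p = (x, y)" "q = (x', y')" by fastforce
  define r t r' t' where defs: "r = real k + 1 - x" "t = 1 - 2 * y" "r' = real k + 1 - x'" "t' = 1 - 2 * y'"
  have r: "r > 0" "r' > 0" using p q by (auto simp: rectangle_def cbox_Pair_eq defs)
  have 1: "r * t = r' * t'" and 2: "r * (1 - \<bar>t\<bar>) = r' * (1 - \<bar>t'\<bar>)"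
    using eq by (auto simp: unfold_rectangle_def defs vec_eq_iff forall_2)
  have "r * \<bar>t\<bar> = r' * \<bar>t'\<bar>" using 1 r by (metis abs_mult abs_of_pos)
  then have "r = r'" using 2 by (simp add: algebra_simps)
  then have "t = t'" using 1 r by simp
  then show "p = q" using \<open>r = r'\<close> by (simp add: defs)
qed

text \<open>The lower side of this box lies on the real axis, where the vertices land, as
  \<open>fashoda_interlace\<close> requires.\<close>

lemma unfold_rectangle_subset:
  "unfold_rectangle k ` rectangle k \<subseteq> cbox (vector [- real k, 0]) (vector [real k, real k])"
proof
  fix z assume "z \<in> unfold_rectangle k ` rectangle k"
  then obtain x y where z: "z = unfold_rectangle k (x, y)" and xy: "1 \<le> x" "x \<le> real k" "0 \<le> y" "y \<le> 1"
    by (auto simp: rectangle_def cbox_Pair_eq)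
  define r t where defs: "r = real k + 1 - x" "t = 1 - 2 * y"
  have b: "0 \<le> r" "r \<le> real k" "\<bar>t\<bar> \<le> 1" using xy by (auto simp: defs)
  have "\<bar>r * t\<bar> \<le> real k" using b by (metis abs_ge_zero abs_mult abs_of_nonneg dual_order.trans mult_left_le)
  moreover have "0 \<le> r * (1 - \<bar>t\<bar>)" using b by simp
  moreover have "r * (1 - \<bar>t\<bar>) \<le> real k"
    using b by (smt (verit) abs_ge_zero mult_left_le)
  ultimately show "z \<in> cbox (vector [- real k, 0]) (vector [real k, real k])"
    by (auto simp: mem_box_cart forall_2 z unfold_rectangle_def defs abs_le_iff)
qed

text \<open>The vertices land on \<open>-k, ..., -1, 1, ..., k\<close> in the order of their labels;
  skipping \<open>0\<close> accounts for the correction on the top row.\<close>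

lemma unfold_rectangle_position:
  assumes "v \<in> vertices k"
  shows "unfold_rectangle k (position v) =
    vector [real (relabel k v) - real k - (if relabel k v \<le> k then 1 else 0), 0]"
  using assms by (auto simp: vertices_def unfold_rectangle_def vec_eq_iff forall_2)

text \<open>After unfolding, the four ends interlace on the lower side of a box, so the Fashoda
  theorem yields a common point, which injectivity brings back to the rectangle.\<close>

lemma interlaced_paths_meet:
  assumes p: "path p" "path_image p \<subseteq> rectangle k"
    "pathstart p = position a" "pathfinish p = position b"
    and q: "path q" "path_image q \<subseteq> rectangle k"
    "pathstart q = position a'" "pathfinish q = position b'"
    and v: "a \<in> vertices k" "b \<in> vertices k" "a' \<in> vertices k" "b' \<in> vertices k"
    and ord: "relabel k a < relabel k a'" "relabel k a' < relabel k b" "relabel k b < relabel k b'"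
  shows "path_image p \<inter> path_image q \<noteq> {}"
proof -
  let ?u = "unfold_rectangle k"
  have paths: "path (?u \<circ> p)" "path (?u \<circ> q)"
    by (simp_all add: p q path_continuous_image continuous_unfold_rectangle)
  have sub: "path_image (?u \<circ> p) \<subseteq> cbox (vector [- real k, 0]) (vector [real k, real k])"
      "path_image (?u \<circ> q) \<subseteq> cbox (vector [- real k, 0]) (vector [real k, real k])"
    using unfold_rectangle_subset[of k] p(2) q(2) unfolding path_image_compose by blast+
  obtain z where z: "z \<in> path_image (?u \<circ> p)" "z \<in> path_image (?u \<circ> q)"
    by (rule fashoda_interlace[OF paths sub])
      (use ord v in \<open>auto simp: pathstart_compose pathfinish_compose p q unfold_rectangle_position\<close>)
  then obtain x y where "x \<in> path_image p" "y \<in> path_image q" "?u x = ?u y"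
    by (auto simp: path_image_compose)
  then show ?thesis
    using inj_on_unfold_rectangle p(2) q(2) by (metis disjoint_iff inj_onD subsetD)
qed

text \<open>The drawn blocks are path connected and pairwise disjoint, whereas crossing standard
  edges yield interlaced vertices in two blocks.\<close>

lemma planar_imp_noncrossing:
  assumes d: "d \<in> partitions k" and pl: "planar k d"
  shows "noncrossing (std_edges k d)"
  unfolding noncrossing_def
proof (intro allI impI notI)
  fix i j i' j'
  assume e: "(i, j) \<in> std_edges k d" "(i', j') \<in> std_edges k d"
    and c: "i < i' \<and> i' < j \<and> j < j'"
  obtain B where B: "B \<in> d" "i \<in> relabel k ` B" "j \<in> relabel k ` B"
      "\<forall>m. i < m \<and> m < j \<longrightarrow> m \<notin> relabel k ` B"
    using e(1) unfolding std_edges_def by blast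
  obtain B' where B': "B' \<in> d" "i' \<in> relabel k ` B'" "j' \<in> relabel k ` B'"
    using e(2) unfolding std_edges_def by blast
  \<comment> \<open>\<open>B = B'\<close> would put \<open>i'\<close> strictly between the
    consecutive elements \<open>i\<close> and \<open>j\<close> of this block.\<close>
  have ne: "B \<noteq> B'" using B B' c by blast
  then have disj: "B \<inter> B' = {}" using block_eq[OF d B(1) B'(1)] by blast
  obtain G \<gamma> where G: "represents k G d" and dr: "plane_drawing k G \<gamma>"
    using pl by (auto simp: planar_def)
  let ?R = "{(u, v). {u, v} \<in> G}"
  \<comment> \<open>The drawn part of a block. The graph \<open>G\<close> may differ from the
    standard one and lack an edge from \<open>i\<close> to \<open>j\<close>, so all arcs within the
    block are collected.\<close>
  define U where "U C = position ` C \<union> \<Union> (path_image ` \<gamma> ` {e \<in> G. e \<subseteq> C})" for C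
  have comp: "?R\<^sup>* `` {u} = C" if "C \<in> d" "u \<in> C" for u C
  proof -
    have "C \<in> vertices k // ?R\<^sup>*"
      using G that by (simp add: represents_def graph_components_def)
    then obtain x where x: "C = ?R\<^sup>* `` {x}" by (auto simp: quotient_def)
    have "sym ?R" by (auto simp: sym_def insert_commute)
    then have "sym (?R\<^sup>*)" by (rule sym_rtrancl)
    then have "(x, u) \<in> ?R\<^sup>*" "(u, x) \<in> ?R\<^sup>*" using x that by (auto dest: symD)
    then show ?thesis unfolding x by (auto intro: rtrancl_trans)
  qed
  have conn: "path_component (U C) (position u) (position v)"
    if C: "C \<in> d" and uv: "u \<in> C" "v \<in> C" for C u v
  proof -
    have "(u, v) \<in> ?R\<^sup>*" using comp[OF C uv(1)] uv by blast
    then show ?thesis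
    proof (induction rule: rtrancl_induct)
      case base
      show ?case using uv by (simp add: path_component_refl U_def)
    next
      case (step y z)
      then have y: "y \<in> C" "z \<in> C" and yz: "{y, z} \<in> G"
        using comp[OF C uv(1)] by (auto intro: rtrancl_into_rtrancl)
      then have sub: "path_image (\<gamma> {y, z}) \<subseteq> U C" by (auto simp: U_def)
      have g: "path (\<gamma> {y, z})"
          "{pathstart (\<gamma> {y, z}), pathfinish (\<gamma> {y, z})} = {position y, position z}"
        using dr yz by (auto simp: plane_drawing_def arc_imp_path)
      have "path_component (U C) (pathstart (\<gamma> {y, z})) (pathfinish (\<gamma> {y, z}))"
        using g(1) sub unfolding path_component_def by blast
      \<comment> \<open>The arc may run from \<open>z\<close> to \<open>y\<close>, since only the
        set of its two ends is prescribed.\<close>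
      then have "path_component (U C) (position y) (position z)"
        using g(2) by (metis doubleton_eq_iff path_component_sym)
      then show ?case using step.IH path_component_trans by blast
    qed
  qed
  have pos_rect: "position ` vertices k \<subseteq> rectangle k"
    by (auto simp: vertices_def rectangle_def cbox_Pair_eq)
  have rect: "U C \<subseteq> rectangle k" if "C \<in> d" for C
    using dr pos_rect block_subset[OF d that] by (auto simp: U_def plane_drawing_def)
  have U_disj: "U B \<inter> U B' = {}"
  proof -
    have inj: "inj position"
    proof (rule injI)
      fix x y assume "position x = position y"
      then show "x = y" by (cases x; cases y) auto
    qed
    have 1: "position ` B \<inter> position ` B' = {}"
      using disj inj by (metis image_Int image_empty)
    have 2: "position ` C \<inter> path_image (\<gamma> e) = {}"
      if "C \<in> d" "e \<in> G" "e \<inter> C = {}" for C e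
    proof -
      have "position ` C \<inter> path_image (\<gamma> e) \<subseteq> position ` e"
      proof -
        have "path_image (\<gamma> e) \<inter> position ` vertices k = position ` e"
          using dr that(2) by (simp add: plane_drawing_def)
        then show ?thesis using block_subset[OF d that(1)] by blast
      qed
      moreover have "position ` e \<inter> position ` C = {}"
        using that(3) inj by (metis image_Int image_empty)
      ultimately show ?thesis by blast
    qed
    have 3: "path_image (\<gamma> e) \<inter> path_image (\<gamma> e') = {}"
      if "e \<in> G" "e' \<in> G" "e \<subseteq> B" "e' \<subseteq> B'" for e e'
    proof -
      have "card e = 2" using G that by (auto simp: represents_def graph_on_def)
      then have "e \<noteq> {}" by auto
      moreover have "e \<inter> e' = {}" using that disj by blast
      \<comment> \<open>The drawing condition speaks of distinct edges only; disjoint nonempty edges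
        are distinct.\<close>
      moreover have "e \<noteq> e'" using calculation by blast
      ultimately show ?thesis using dr that by (auto simp: plane_drawing_def)
    qed
    have "x \<notin> U B'" if "x \<in> U B" for x
    proof
      assume x': "x \<in> U B'"
      have x1: "x \<in> position ` B \<or> (\<exists>e\<in>G. e \<subseteq> B \<and> x \<in> path_image (\<gamma> e))"
        using that by (auto simp: U_def)
      have x2: "x \<in> position ` B' \<or> (\<exists>e\<in>G. e \<subseteq> B' \<and> x \<in> path_image (\<gamma> e))"
        using x' by (auto simp: U_def)
      have q: "e \<inter> B' = {}" if "e \<subseteq> B" for e using disj that by blast
      have q': "e \<inter> B = {}" if "e \<subseteq> B'" for e using disj that by blast
      from x1 x2 show False
      proof (elim disjE bexE conjE)
        assume "x \<in> position ` B" "x \<in> position ` B'"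
        then show False using 1 by blast
      next
        fix e assume "x \<in> position ` B" "e \<in> G" "e \<subseteq> B'" "x \<in> path_image (\<gamma> e)"
        then show False using 2[OF B(1) _ q'] by blast
      next
        fix e assume "x \<in> position ` B'" "e \<in> G" "e \<subseteq> B" "x \<in> path_image (\<gamma> e)"
        then show False using 2[OF B'(1) _ q] by blast
      next
        fix e e' assume "e \<in> G" "e \<subseteq> B" "x \<in> path_image (\<gamma> e)"
          "e' \<in> G" "e' \<subseteq> B'" "x \<in> path_image (\<gamma> e')"
        then show False using 3[of e e'] by blast
      qed
    qed
    then show ?thesis by blast
  qed
  have Bsub: "B \<subseteq> vertices k" "B' \<subseteq> vertices k" using block_subset[OF d] B(1) B'(1) by auto
  obtain a b where ab: "a \<in> B" "b \<in> B" "i = relabel k a" "j = relabel k b" using B by blast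
  obtain a' b' where ab': "a' \<in> B'" "b' \<in> B'" "i' = relabel k a'" "j' = relabel k b'" using B' by blast
  obtain p where p: "path p" "path_image p \<subseteq> U B" "pathstart p = position a" "pathfinish p = position b"
    using conn[OF B(1) ab(1,2)] unfolding path_component_def by blast
  obtain q where q: "path q" "path_image q \<subseteq> U B'" "pathstart q = position a'" "pathfinish q = position b'"
    using conn[OF B'(1) ab'(1,2)] unfolding path_component_def by blast
  have "path_image p \<inter> path_image q \<noteq> {}"
    using ab ab' Bsub c rect[OF B(1)] rect[OF B'(1)] p q
    by (intro interlaced_paths_meet[of p k a b q a' b']) auto
  then show False using U_disj p(2) q(2) by blast
qed

theorem proposition5p3:
  fixes k :: nat and d :: "vertex set set"
  assumes "k \<ge> 1" and "d \<in> partitions k"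
  shows "planar k d \<longleftrightarrow> (\<forall>n\<in>{0..4 * k}. num_parts (insertion_shape k d n) \<le> 1)"
  using planar_imp_noncrossing noncrossing_imp_planar noncrossing_iff_num_parts assms(2) by blast

end
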